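(* Let $P:\mathbb C^{\mathrm{op}}\to\mathbf{Pos}$ be a primary doctrine, $X$ an object of $\mathbb C$ and $\varphi\in P(X)$, and let $P_{(X,\varphi)}$ be the associated Kleisli doctrine with canonical 1-arrow $(F_X,\mathfrak f):P\to P_{(X,\varphi)}$. If $P$ is a Boolean doctrine, then $P_{(X,\varphi)}$ is a Boolean doctrine, and $(F_X,\mathfrak f)$ is a Boolean homomorphism.
   Context: A doctrine is a functor $P:\mathbb C^{\mathrm{op}}\to\mathbf{Pos}$ with $\mathbb C$ a category with finite products and $\mathbf{Pos}$ the category of posets and monotone maps; the maps $P(f)$ are called reindexings. It is primary if every $P(A)$ has finite meets ($\wedge$, $\top$) and all reindexings preserve them. It is Heyting if every $P(A)$ is a Heyting algebra and all reindexings preserve $\wedge,\top,\to,\vee,\bot$; it is Boolean if it is Heyting and $\neg(-)=(-)\to\bot:P^{\mathrm{op}}\to P$ is an isomorphism (i.e. each $P(A)$ is a Boolean algebra). A 1-arrow (doctrine homomorphism) from $P:\mathbb C^{\mathrm{op}}\to\mathbf{Pos}$ to $R:\mathbb D^{\mathrm{op}}\to\mathbf{Pos}$ is a pair $(F,\mathfrak f)$ with $F:\mathbb C\to\mathbb D$ a finite-product-preserving functor and $\mathfrak f:P\to R\circ F^{\mathrm{op}}$ natural; it is Boolean if $P,R$ are Boolean and each $\mathfrak f_A$ preserves the Boolean structure. Kleisli doctrine (the Kleisli object of the comonad on $P$ given by $X\times-$ and $\alpha\mapsto P(\mathrm{pr}_1)(\varphi)\wedge P(\mathrm{pr}_2)(\alpha)$).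 The category $\mathbb C_X$ has the same objects as $\mathbb C$; an arrow $g:A\rightsquigarrow B$ in $\mathbb C_X$ is a $\mathbb C$-arrow $g:X\times A\to B$; the identity of $A$ is $\mathrm{pr}_2:X\times A\to A$; the composite of $g:A\rightsquigarrow B$ and $h:B\rightsquigarrow C$ is $h\langle\mathrm{pr}_1,g\rangle$. It has finite products, given on objects by those of $\mathbb C$. The doctrine $P_{(X,\varphi)}:\mathbb C_X^{\mathrm{op}}\to\mathbf{Pos}$ has $P_{(X,\varphi)}(A)=\{\alpha\in P(X\times A)\mid\alpha\le P(\mathrm{pr}_1)(\varphi)\}$ with the order of $P(X\times A)$, and reindexing along $g:A\rightsquigarrow B$ is the restriction of $P(\langle\mathrm{pr}_1,g\rangle)$. The 1-arrow $(F_X,\mathfrak f):P\to P_{(X,\varphi)}$: $F_X:\mathbb C\to\mathbb C_X$ is the identity on objects and sends $f:A\to B$ to $f\,\mathrm{pr}_2:A\rightsquigarrow B$; $\mathfrak f_A(\alpha)=P(\mathrm{pr}_1)(\varphi)\wedge P(\mathrm{pr}_2)(\alpha)$, for $\mathrm{pr}_1,\mathrm{pr}_2$ the projections from $X\times A$. *)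

theory Defs
  imports "HOL-Algebra.Lattice"
begin

section \<open>Categories with finite products\<close>

text \<open>
  Hom-sets form a family indexed by pairs of objects and need not be disjoint, so that an arrow
  from \<open>A\<close> to \<open>B\<close> of the Kleisli category can literally be an arrow \<open>X \<times> A \<rightarrow> B\<close>. Hence
  composition (and, below, functors and reindexings) take the objects involved as arguments:
  \<open>Comp C A B D g f\<close> is the composite of \<open>f : A \<rightarrow> B\<close> followed by \<open>g : B \<rightarrow> D\<close>.
\<close>

record ('o, 'a) cat =
  Obj  :: "'o set"
  Hom  :: "'o \<Rightarrow> 'o \<Rightarrow> 'a set"
  Ident :: "'o \<Rightarrow> 'a"
  Comp :: "'o \<Rightarrow> 'o \<Rightarrow> 'o \<Rightarrow> 'a \<Rightarrow> 'a \<Rightarrow> 'a"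

locale category =
  fixes C :: "('o, 'a, 'm) cat_scheme"
  assumes ident_in_hom: "A \<in> Obj C \<Longrightarrow> Ident C A \<in> Hom C A A"
    and comp_in_hom:
      "\<lbrakk>A \<in> Obj C; B \<in> Obj C; D \<in> Obj C; f \<in> Hom C A B; g \<in> Hom C B D\<rbrakk>
        \<Longrightarrow> Comp C A B D g f \<in> Hom C A D"
    and comp_ident_right:
      "\<lbrakk>A \<in> Obj C; B \<in> Obj C; f \<in> Hom C A B\<rbrakk> \<Longrightarrow> Comp C A A B f (Ident C A) = f"
    and comp_ident_left:
      "\<lbrakk>A \<in> Obj C; B \<in> Obj C; f \<in> Hom C A B\<rbrakk> \<Longrightarrow> Comp C A B B (Ident C B) f = f"
    and comp_assoc:
      "\<lbrakk>A \<in> Obj C; B \<in> Obj C; D \<in> Obj C; E \<in> Obj C;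
        f \<in> Hom C A B; g \<in> Hom C B D; h \<in> Hom C D E\<rbrakk>
        \<Longrightarrow> Comp C A D E h (Comp C A B D g f) = Comp C A B E (Comp C B D E h g) f"

definition is_terminal :: "('o, 'a, 'm) cat_scheme \<Rightarrow> 'o \<Rightarrow> bool" where
  "is_terminal C T \<longleftrightarrow> T \<in> Obj C \<and> (\<forall>A\<in>Obj C. \<exists>!h. h \<in> Hom C A T)"

definition is_product ::
  "('o, 'a, 'm) cat_scheme \<Rightarrow> 'o \<Rightarrow> 'o \<Rightarrow> 'o \<Rightarrow> 'a \<Rightarrow> 'a \<Rightarrow> bool" where
  "is_product C A B Q p q \<longleftrightarrow>
     Q \<in> Obj C \<and> p \<in> Hom C Q A \<and> q \<in> Hom C Q B \<and>
     (\<forall>Z\<in>Obj C. \<forall>f\<in>Hom C Z A. \<forall>g\<in>Hom C Z B.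
        \<exists>!h. h \<in> Hom C Z Q \<and> Comp C Z Q A p h = f \<and> Comp C Z Q B q h = g)"

text \<open>Finite products are a chosen terminal object and chosen binary products.\<close>

record ('o, 'a) fpcat = "('o, 'a) cat" +
  Term :: "'o"
  Prod :: "'o \<Rightarrow> 'o \<Rightarrow> 'o"
  Pr1  :: "'o \<Rightarrow> 'o \<Rightarrow> 'a"
  Pr2  :: "'o \<Rightarrow> 'o \<Rightarrow> 'a"

locale fp_category = category C for C :: "('o, 'a, 'm) fpcat_scheme" +
  assumes terminal: "is_terminal C (Term C)"
    and product:
      "\<lbrakk>A \<in> Obj C; B \<in> Obj C\<rbrakk> \<Longrightarrow> is_product C A B (Prod C A B) (Pr1 C A B) (Pr2 C A B)"

definition pairing ::
  "('o, 'a, 'm) fpcat_scheme \<Rightarrow> 'o \<Rightarrow> 'o \<Rightarrow> 'o \<Rightarrow> 'a \<Rightarrow> 'a \<Rightarrow> 'a" where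
  "pairing C Z A B f g =
     (THE h. h \<in> Hom C Z (Prod C A B) \<and>
        Comp C Z (Prod C A B) A (Pr1 C A B) h = f \<and>
        Comp C Z (Prod C A B) B (Pr2 C A B) h = g)"

record ('o, 'a, 'o2, 'b) fctr =
  fobj :: "'o \<Rightarrow> 'o2"
  farr :: "'o \<Rightarrow> 'o \<Rightarrow> 'a \<Rightarrow> 'b"

definition is_functor ::
  "('o, 'a, 'm) cat_scheme \<Rightarrow> ('o2, 'b, 'n) cat_scheme \<Rightarrow> ('o, 'a, 'o2, 'b) fctr \<Rightarrow> bool" where
  "is_functor C D F \<longleftrightarrow>
     category C \<and> category D \<and>
     (\<forall>A\<in>Obj C. fobj F A \<in> Obj D) \<and>
     (\<forall>A\<in>Obj C. \<forall>B\<in>Obj C. \<forall>f\<in>Hom C A B. farr F A B f \<in> Hom D (fobj F A) (fobj F B)) \<and>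
     (\<forall>A\<in>Obj C. farr F A A (Ident C A) = Ident D (fobj F A)) \<and>
     (\<forall>A\<in>Obj C. \<forall>B\<in>Obj C. \<forall>E\<in>Obj C. \<forall>f\<in>Hom C A B. \<forall>g\<in>Hom C B E.
        farr F A E (Comp C A B E g f) =
          Comp D (fobj F A) (fobj F B) (fobj F E) (farr F B E g) (farr F A B f))"

text \<open>
  Preservation is meant up to isomorphism: all terminal objects and all product cones are sent to
  terminal objects and product cones, with no reference to the chosen ones.
\<close>

definition preserves_finite_products ::
  "('o, 'a, 'm) cat_scheme \<Rightarrow> ('o2, 'b, 'n) cat_scheme \<Rightarrow> ('o, 'a, 'o2, 'b) fctr \<Rightarrow> bool" where
  "preserves_finite_products C D F \<longleftrightarrow>
     (\<forall>T. is_terminal C T \<longrightarrow> is_terminal D (fobj F T)) \<and>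
     (\<forall>A\<in>Obj C. \<forall>B\<in>Obj C. \<forall>Q p q. is_product C A B Q p q \<longrightarrow>
        is_product D (fobj F A) (fobj F B) (fobj F Q) (farr F Q A p) (farr F Q B q))"


section \<open>Heyting algebras\<close>

locale heyting_algebra = bounded_lattice L for L (structure) +
  assumes imp_exists:
    "\<lbrakk>a \<in> carrier L; b \<in> carrier L\<rbrakk> \<Longrightarrow>
      \<exists>c\<in>carrier L. \<forall>x\<in>carrier L. x \<sqsubseteq> c \<longleftrightarrow> x \<sqinter> a \<sqsubseteq> b"

definition imp :: "('p, 'm) gorder_scheme \<Rightarrow> 'p \<Rightarrow> 'p \<Rightarrow> 'p" where
  "imp L a b =
     (THE c. c \<in> carrier L \<and> (\<forall>x\<in>carrier L. x \<sqsubseteq>\<^bsub>L\<^esub> c \<longleftrightarrow> x \<sqinter>\<^bsub>L\<^esub> a \<sqsubseteq>\<^bsub>L\<^esub> b))"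

definition neg :: "('p, 'm) gorder_scheme \<Rightarrow> 'p \<Rightarrow> 'p" where
  "neg L a = imp L a \<bottom>\<^bsub>L\<^esub>"

definition preserves_finite_meets ::
  "('p, 'm) gorder_scheme \<Rightarrow> ('q, 'n) gorder_scheme \<Rightarrow> ('p \<Rightarrow> 'q) \<Rightarrow> bool" where
  "preserves_finite_meets L M h \<longleftrightarrow>
     h \<top>\<^bsub>L\<^esub> = \<top>\<^bsub>M\<^esub> \<and>
     (\<forall>a\<in>carrier L. \<forall>b\<in>carrier L. h (a \<sqinter>\<^bsub>L\<^esub> b) = h a \<sqinter>\<^bsub>M\<^esub> h b)"

definition preserves_heyting ::
  "('p, 'm) gorder_scheme \<Rightarrow> ('q, 'n) gorder_scheme \<Rightarrow> ('p \<Rightarrow> 'q) \<Rightarrow> bool" where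
  "preserves_heyting L M h \<longleftrightarrow>
     preserves_finite_meets L M h \<and>
     h \<bottom>\<^bsub>L\<^esub> = \<bottom>\<^bsub>M\<^esub> \<and>
     (\<forall>a\<in>carrier L. \<forall>b\<in>carrier L. h (a \<squnion>\<^bsub>L\<^esub> b) = h a \<squnion>\<^bsub>M\<^esub> h b) \<and>
     (\<forall>a\<in>carrier L. \<forall>b\<in>carrier L. h (imp L a b) = imp M (h a) (h b))"


section \<open>Doctrines\<close>

text \<open>\<open>reind P A B f\<close> is the map \<open>P(f) : P(B) \<rightarrow> P(A)\<close> for \<open>f : A \<rightarrow> B\<close>.\<close>

record ('o, 'a, 'p) doctr =
  base  :: "('o, 'a) fpcat"
  fib   :: "'o \<Rightarrow> 'p gorder"
  reind :: "'o \<Rightarrow> 'o \<Rightarrow> 'a \<Rightarrow> 'p \<Rightarrow> 'p"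

definition doctrine :: "('o, 'a, 'p) doctr \<Rightarrow> bool" where
  "doctrine P \<longleftrightarrow>
     fp_category (base P) \<and>
     (\<forall>A\<in>Obj (base P). partial_order (fib P A)) \<and>
     (\<forall>A\<in>Obj (base P). \<forall>B\<in>Obj (base P). \<forall>f\<in>Hom (base P) A B.
        reind P A B f \<in> carrier (fib P B) \<rightarrow> carrier (fib P A) \<and>
        isotone (fib P B) (fib P A) (reind P A B f)) \<and>
     (\<forall>A\<in>Obj (base P). \<forall>\<alpha>\<in>carrier (fib P A). reind P A A (Ident (base P) A) \<alpha> = \<alpha>) \<and>
     (\<forall>A\<in>Obj (base P). \<forall>B\<in>Obj (base P). \<forall>D\<in>Obj (base P).
        \<forall>f\<in>Hom (base P) A B. \<forall>g\<in>Hom (base P) B D. \<forall>\<alpha>\<in>carrier (fib P D).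
          reind P A D (Comp (base P) A B D g f) \<alpha> = reind P A B f (reind P B D g \<alpha>))"

definition primary_doctrine :: "('o, 'a, 'p) doctr \<Rightarrow> bool" where
  "primary_doctrine P \<longleftrightarrow>
     doctrine P \<and>
     (\<forall>A\<in>Obj (base P). lower_semilattice (fib P A) \<and> weak_partial_order_top (fib P A)) \<and>
     (\<forall>A\<in>Obj (base P). \<forall>B\<in>Obj (base P). \<forall>f\<in>Hom (base P) A B.
        preserves_finite_meets (fib P B) (fib P A) (reind P A B f))"

definition heyting_doctrine :: "('o, 'a, 'p) doctr \<Rightarrow> bool" where
  "heyting_doctrine P \<longleftrightarrow>
     doctrine P \<and>
     (\<forall>A\<in>Obj (base P). heyting_algebra (fib P A)) \<and>
     (\<forall>A\<in>Obj (base P). \<forall>B\<in>Obj (base P). \<forall>f\<in>Hom (base P) A B.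
        preserves_heyting (fib P B) (fib P A) (reind P A B f))"

definition doctrine_trans ::
  "('o, 'a, 'p) doctr \<Rightarrow> ('o, 'a, 'q) doctr \<Rightarrow> ('o \<Rightarrow> 'p \<Rightarrow> 'q) \<Rightarrow> bool" where
  "doctrine_trans P Q \<eta> \<longleftrightarrow>
     base Q = base P \<and>
     (\<forall>A\<in>Obj (base P). \<eta> A \<in> carrier (fib P A) \<rightarrow> carrier (fib Q A) \<and>
        isotone (fib P A) (fib Q A) (\<eta> A)) \<and>
     (\<forall>A\<in>Obj (base P). \<forall>B\<in>Obj (base P). \<forall>f\<in>Hom (base P) A B. \<forall>\<beta>\<in>carrier (fib P B).
        \<eta> A (reind P A B f \<beta>) = reind Q A B f (\<eta> B \<beta>))"

definition doctrine_iso ::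
  "('o, 'a, 'p) doctr \<Rightarrow> ('o, 'a, 'q) doctr \<Rightarrow> ('o \<Rightarrow> 'p \<Rightarrow> 'q) \<Rightarrow> bool" where
  "doctrine_iso P Q \<eta> \<longleftrightarrow>
     doctrine_trans P Q \<eta> \<and>
     (\<forall>A\<in>Obj (base P). bij_betw (\<eta> A) (carrier (fib P A)) (carrier (fib Q A)) \<and>
        order_emb (fib P A) (fib Q A) (\<eta> A))"

text \<open>\<open>P\<^sup>o\<^sup>p\<close> reverses the order of the fibres; its base category is unchanged.\<close>

definition op_doctrine :: "('o, 'a, 'p) doctr \<Rightarrow> ('o, 'a, 'p) doctr" where
  "op_doctrine P = P\<lparr>fib := \<lambda>A. inv_gorder (fib P A)\<rparr>"

definition boolean_doctrine :: "('o, 'a, 'p) doctr \<Rightarrow> bool" where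
  "boolean_doctrine P \<longleftrightarrow>
     heyting_doctrine P \<and> doctrine_iso (op_doctrine P) P (\<lambda>A. neg (fib P A))"

text \<open>\<open>reindex_functor R C F\<close> is \<open>R \<circ> F\<^sup>o\<^sup>p\<close> for a functor \<open>F\<close> from \<open>C\<close> to the base of \<open>R\<close>.\<close>

definition reindex_functor ::
  "('o2, 'b, 'q) doctr \<Rightarrow> ('o, 'a) fpcat \<Rightarrow> ('o, 'a, 'o2, 'b) fctr \<Rightarrow> ('o, 'a, 'q) doctr" where
  "reindex_functor R C F =
     \<lparr>base = C,
      fib = (\<lambda>A. fib R (fobj F A)),
      reind = (\<lambda>A B f. reind R (fobj F A) (fobj F B) (farr F A B f))\<rparr>"

definition doctrine_hom ::
  "('o, 'a, 'p) doctr \<Rightarrow> ('o2, 'b, 'q) doctr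
    \<Rightarrow> ('o, 'a, 'o2, 'b) fctr \<times> ('o \<Rightarrow> 'p \<Rightarrow> 'q) \<Rightarrow> bool" where
  "doctrine_hom P R = (\<lambda>(F, \<ff>).
     doctrine P \<and> doctrine R \<and>
     is_functor (base P) (base R) F \<and>
     preserves_finite_products (base P) (base R) F \<and>
     doctrine_trans P (reindex_functor R (base P) F) \<ff>)"

text \<open>Negation is \<open>(-) \<rightarrow> \<bottom>\<close>, so preserving the Heyting operations includes preserving it.\<close>

definition boolean_hom ::
  "('o, 'a, 'p) doctr \<Rightarrow> ('o2, 'b, 'q) doctr
    \<Rightarrow> ('o, 'a, 'o2, 'b) fctr \<times> ('o \<Rightarrow> 'p \<Rightarrow> 'q) \<Rightarrow> bool" where
  "boolean_hom P R = (\<lambda>(F, \<ff>).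
     boolean_doctrine P \<and> boolean_doctrine R \<and> doctrine_hom P R (F, \<ff>) \<and>
     (\<forall>A\<in>Obj (base P). preserves_heyting (fib P A) (fib R (fobj F A)) (\<ff> A)))"


section \<open>The Kleisli doctrine\<close>

text \<open>\<open>kleisli_lift C X A B g\<close> is \<open>\<langle>pr\<^sub>1, g\<rangle> : X \<times> A \<rightarrow> X \<times> B\<close> for \<open>g : X \<times> A \<rightarrow> B\<close>.\<close>

definition kleisli_lift ::
  "('o, 'a, 'm) fpcat_scheme \<Rightarrow> 'o \<Rightarrow> 'o \<Rightarrow> 'o \<Rightarrow> 'a \<Rightarrow> 'a" where
  "kleisli_lift C X A B g = pairing C (Prod C X A) X B (Pr1 C X A) g"

text \<open>The projections of the Kleisli category are the images under \<open>F\<^sub>X\<close> of those of \<open>C\<close>.\<close>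

definition kleisli_category :: "('o, 'a) fpcat \<Rightarrow> 'o \<Rightarrow> ('o, 'a) fpcat" where
  "kleisli_category C X =
     \<lparr>Obj = Obj C,
      Hom = (\<lambda>A B. Hom C (Prod C X A) B),
      Ident = (\<lambda>A. Pr2 C X A),
      Comp = (\<lambda>A B D h g. Comp C (Prod C X A) (Prod C X B) D h (kleisli_lift C X A B g)),
      Term = Term C,
      Prod = Prod C,
      Pr1 = (\<lambda>A B. Comp C (Prod C X (Prod C A B)) (Prod C A B) A
                     (Pr1 C A B) (Pr2 C X (Prod C A B))),
      Pr2 = (\<lambda>A B. Comp C (Prod C X (Prod C A B)) (Prod C A B) B
                     (Pr2 C A B) (Pr2 C X (Prod C A B)))\<rparr>"

definition kleisli_doctrine ::
  "('o, 'a, 'p) doctr \<Rightarrow> 'o \<Rightarrow> 'p \<Rightarrow> ('o, 'a, 'p) doctr" where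
  "kleisli_doctrine P X \<phi> = (let C = base P in
     \<lparr>base = kleisli_category C X,
      fib = (\<lambda>A. let XA = Prod C X A in
               (fib P XA)\<lparr>carrier :=
                 {\<alpha> \<in> carrier (fib P XA). \<alpha> \<sqsubseteq>\<^bsub>fib P XA\<^esub> reind P XA X (Pr1 C X A) \<phi>}\<rparr>),
      reind = (\<lambda>A B g. reind P (Prod C X A) (Prod C X B) (kleisli_lift C X A B g))\<rparr>)"

definition kleisli_functor :: "('o, 'a) fpcat \<Rightarrow> 'o \<Rightarrow> ('o, 'a, 'o, 'a) fctr" where
  "kleisli_functor C X =
     \<lparr>fobj = (\<lambda>A. A),
      farr = (\<lambda>A B f. Comp C (Prod C X A) A B f (Pr2 C X A))\<rparr>"

definition kleisli_trans :: "('o, 'a, 'p) doctr \<Rightarrow> 'o \<Rightarrow> 'p \<Rightarrow> 'o \<Rightarrow> 'p \<Rightarrow> 'p" where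
  "kleisli_trans P X \<phi> A \<alpha> = (let C = base P; XA = Prod C X A in
     reind P XA X (Pr1 C X A) \<phi> \<sqinter>\<^bsub>fib P XA\<^esub> reind P XA A (Pr2 C X A) \<alpha>)"

definition kleisli_hom ::
  "('o, 'a, 'p) doctr \<Rightarrow> 'o \<Rightarrow> 'p \<Rightarrow> ('o, 'a, 'o, 'a) fctr \<times> ('o \<Rightarrow> 'p \<Rightarrow> 'p)" where
  "kleisli_hom P X \<phi> = (kleisli_functor (base P) X, kleisli_trans P X \<phi>)"

end

theory Submission
  imports Defs
begin

text \<open>
  The fibre of the Kleisli doctrine over \<open>A\<close> is the principal down-set of
  \<open>p = P(pr\<^sub>1)(\<phi>)\<close> in \<open>P(X \<times> A)\<close>. The down-set of \<open>p\<close> in a Heyting algebra is again one,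
  with implication \<open>p \<sqinter> (a \<rightarrow> b)\<close>, and \<open>p \<sqinter> (-)\<close> is a Heyting homomorphism onto it; hence it
  inherits \<open>\<not>\<not>a = a\<close>. A homomorphism \<open>h\<close> restricts to the down-sets of \<open>p\<close> and \<open>h(p)\<close>, and
  reindexing along \<open>\<langle>pr\<^sub>1, g\<rangle>\<close> maps \<open>P(pr\<^sub>1)(\<phi>)\<close> to \<open>P(pr\<^sub>1)(\<phi>)\<close>.
\<close>

section \<open>Principal down-sets of Heyting algebras\<close>

definition down :: "('p, 'm) gorder_scheme \<Rightarrow> 'p \<Rightarrow> ('p, 'm) gorder_scheme" where
  "down L p = L\<lparr>carrier := {a \<in> carrier L. a \<sqsubseteq>\<^bsub>L\<^esub> p}\<rparr>"

lemma carrier_down [simp]: "carrier (down L p) = {a \<in> carrier L. a \<sqsubseteq>\<^bsub>L\<^esub> p}"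
  and le_down [simp]: "le (down L p) = le L"
  and eq_down [simp]: "eq (down L p) = eq L"
  by (simp_all add: down_def)

lemma (in partial_order) partial_order_down: "partial_order (down L p)"
proof -
  interpret D: weak_partial_order "down L p"
    unfolding down_def by (rule weak_partial_order_subset) (auto simp: weak_partial_order_axioms)
  show ?thesis by unfold_locales (simp add: eq_is_equal)
qed

text \<open>Meet, join, top and bottom are Hilbert choices of an extremal element. Antisymmetry
  leaves one candidate, so exhibiting it computes the operation. This and the next three lemmas
  assume only a partial order, hence they apply to \<open>down L p\<close> before it is known to be
  a lattice.\<close>

lemma (in partial_order) meet_eqI:
  "is_glb L c {a, b} \<Longrightarrow> a \<sqinter> b = c"
  unfolding meet_def inf_def by (rule some_equality) (auto intro: greatest_unique)

lemma (in partial_order) join_eqI: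
  "is_lub L c {a, b} \<Longrightarrow> a \<squnion> b = c"
  unfolding join_def sup_def by (rule some_equality) (auto intro: least_unique)

lemma (in partial_order) top_eqI: "greatest L c (carrier L) \<Longrightarrow> \<top> = c"
  unfolding top_def by (rule some_equality) (auto intro: greatest_unique)

lemma (in partial_order) bottom_eqI: "least L c (carrier L) \<Longrightarrow> \<bottom> = c"
  unfolding bottom_def by (rule some_equality) (auto intro: least_unique)

text \<open>The Yoneda principle for posets: each element is tested against the other. It turns
  later identities into comparisons of lower elements.\<close>

lemma (in partial_order) eq_if_same_lower:
  assumes "a \<in> carrier L" "b \<in> carrier L" "\<And>x. x \<in> carrier L \<Longrightarrow> x \<sqsubseteq> a \<longleftrightarrow> x \<sqsubseteq> b"
  shows "a = b"
  using assms by (intro le_antisym) auto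

text \<open>Two elements with this adjointness property lie below each other, so the definite
  description in \<open>imp\<close> denotes \<open>c\<close>.\<close>

lemma (in partial_order) imp_eqI:
  assumes "c \<in> carrier L" "\<And>x. x \<in> carrier L \<Longrightarrow> x \<sqsubseteq> c \<longleftrightarrow> x \<sqinter> a \<sqsubseteq> b"
  shows "imp L a b = c"
  unfolding imp_def by (rule the_equality) (use assms in \<open>auto intro!: le_antisym\<close>)

lemma (in lower_semilattice) le_meet_iff:
  "\<lbrakk>x \<in> carrier L; a \<in> carrier L; b \<in> carrier L\<rbrakk> \<Longrightarrow> x \<sqsubseteq> a \<sqinter> b \<longleftrightarrow> x \<sqsubseteq> a \<and> x \<sqsubseteq> b"
  by (meson le_trans meet_closed meet_le meet_left meet_right)

lemma (in upper_semilattice) join_le_iff: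
  "\<lbrakk>x \<in> carrier L; a \<in> carrier L; b \<in> carrier L\<rbrakk> \<Longrightarrow> a \<squnion> b \<sqsubseteq> x \<longleftrightarrow> a \<sqsubseteq> x \<and> b \<sqsubseteq> x"
  by (meson le_trans join_closed join_le join_left join_right)

section \<open>Implication, negation and distributivity in a Heyting algebra\<close>

context heyting_algebra
begin

lemma imp_closed_adjoint:
  assumes "a \<in> carrier L" "b \<in> carrier L"
  shows "imp L a b \<in> carrier L \<and> (\<forall>x\<in>carrier L. x \<sqsubseteq> imp L a b \<longleftrightarrow> x \<sqinter> a \<sqsubseteq> b)"
  using imp_exists[OF assms] imp_eqI[of _ a b] by metis

lemma imp_closed [simp]: "\<lbrakk>a \<in> carrier L; b \<in> carrier L\<rbrakk> \<Longrightarrow> imp L a b \<in> carrier L"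
  using imp_closed_adjoint by blast

lemma le_imp_iff:
  "\<lbrakk>x \<in> carrier L; a \<in> carrier L; b \<in> carrier L\<rbrakk> \<Longrightarrow> x \<sqsubseteq> imp L a b \<longleftrightarrow> x \<sqinter> a \<sqsubseteq> b"
  using imp_closed_adjoint by blast

lemma neg_closed [simp]: "a \<in> carrier L \<Longrightarrow> neg L a \<in> carrier L"
  by (simp add: neg_def)

lemma le_neg_iff: "\<lbrakk>x \<in> carrier L; a \<in> carrier L\<rbrakk> \<Longrightarrow> x \<sqsubseteq> neg L a \<longleftrightarrow> x \<sqinter> a \<sqsubseteq> \<bottom>"
  by (simp add: neg_def le_imp_iff)

text \<open>Both sides say that the meet of \<open>x\<close> and \<open>a\<close> lies below bottom.
  Negation is thus adjoint to itself, which yields the next three lemmas.\<close>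

lemma neg_galois: "\<lbrakk>x \<in> carrier L; a \<in> carrier L\<rbrakk> \<Longrightarrow> x \<sqsubseteq> neg L a \<longleftrightarrow> a \<sqsubseteq> neg L x"
  by (simp add: le_neg_iff meet_comm[of L x a])

lemma le_neg_neg: "a \<in> carrier L \<Longrightarrow> a \<sqsubseteq> neg L (neg L a)"
  using neg_galois[of a "neg L a"] by simp

lemma neg_antimono: "\<lbrakk>a \<in> carrier L; b \<in> carrier L; a \<sqsubseteq> b\<rbrakk> \<Longrightarrow> neg L b \<sqsubseteq> neg L a"
  by (metis le_neg_neg le_trans neg_closed neg_galois)

lemma neg_neg_neg: "a \<in> carrier L \<Longrightarrow> neg L (neg L (neg L a)) = neg L a"
  by (meson le_antisym le_neg_neg neg_antimono neg_closed)

text \<open>Meeting with \<open>p\<close> is left adjoint to \<open>imp L p\<close>, so it preserves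
  joins. The first inequality uses this adjunction; the second holds in every lattice.\<close>

lemma meet_distrib_join:
  assumes "p \<in> carrier L" "a \<in> carrier L" "b \<in> carrier L"
  shows "p \<sqinter> (a \<squnion> b) = (p \<sqinter> a) \<squnion> (p \<sqinter> b)"
proof (rule le_antisym)
  let ?c = "(p \<sqinter> a) \<squnion> (p \<sqinter> b)"
  have "a \<sqsubseteq> imp L p ?c" "b \<sqsubseteq> imp L p ?c"
    using assms by (simp_all add: le_imp_iff meet_comm[of L _ p] join_left join_right)
  then have "a \<squnion> b \<sqsubseteq> imp L p ?c"
    using assms by (simp only: join_le imp_closed join_closed meet_closed)
  then have "(a \<squnion> b) \<sqinter> p \<sqsubseteq> ?c"
    using assms by (subst le_imp_iff[symmetric]) simp_all
  then show "p \<sqinter> (a \<squnion> b) \<sqsubseteq> ?c"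
    by (simp only: meet_comm[of L p "a \<squnion> b"])
next
  have "a \<sqsubseteq> a \<squnion> b" "b \<sqsubseteq> a \<squnion> b"
    using assms by (simp_all add: join_left join_right)
  then show "(p \<sqinter> a) \<squnion> (p \<sqinter> b) \<sqsubseteq> p \<sqinter> (a \<squnion> b)"
    using assms by (simp add: join_le_iff le_meet_iff meet_left)
      (meson join_closed le_trans meet_closed meet_right)
qed (use assms in auto)

section \<open>The down-set of a fixed element \<open>p\<close>\<close>

context
  fixes p
  assumes p: "p \<in> carrier L"
begin

interpretation D: partial_order "down L p"
  by (rule partial_order_down)

lemma meet_le_left_trans:
  "\<lbrakk>a \<in> carrier L; b \<in> carrier L; a \<sqsubseteq> p\<rbrakk> \<Longrightarrow> a \<sqinter> b \<sqsubseteq> p"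
  by (meson p le_trans meet_closed meet_left)

lemma top_down: "\<top>\<^bsub>down L p\<^esub> = p"
  by (rule D.top_eqI) (auto simp: greatest_def p)

lemma bottom_down: "\<bottom>\<^bsub>down L p\<^esub> = \<bottom>"
  by (rule D.bottom_eqI) (auto simp: least_def p)

text \<open>The meet stays in the down-set because \<open>a\<close> does. This bound serves both to
  compute the meet and to show that it exists; the next lemma does the same for joins, where
  \<open>p\<close> is an upper bound of both elements.\<close>

lemma is_glb_down:
  "\<lbrakk>a \<in> carrier (down L p); b \<in> carrier (down L p)\<rbrakk> \<Longrightarrow> is_glb (down L p) (a \<sqinter> b) {a, b}"
  by (rule greatest_LowerI) (auto simp: Lower_def meet_left meet_right le_meet_iff meet_le_left_trans)

lemma is_lub_down:
  "\<lbrakk>a \<in> carrier (down L p); b \<in> carrier (down L p)\<rbrakk> \<Longrightarrow> is_lub (down L p) (a \<squnion> b) {a, b}"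
  by (rule least_UpperI) (auto simp: Upper_def join_left join_right join_le_iff p)

lemma meet_down:
  "\<lbrakk>a \<in> carrier (down L p); b \<in> carrier (down L p)\<rbrakk> \<Longrightarrow> a \<sqinter>\<^bsub>down L p\<^esub> b = a \<sqinter> b"
  by (rule D.meet_eqI) (rule is_glb_down)

lemma join_down:
  "\<lbrakk>a \<in> carrier (down L p); b \<in> carrier (down L p)\<rbrakk> \<Longrightarrow> a \<squnion>\<^bsub>down L p\<^esub> b = a \<squnion> b"
  by (rule D.join_eqI) (rule is_lub_down)

text \<open>The factor \<open>p\<close> forces the implication, which may leave the down-set, back
  into it. It costs nothing, since every test element \<open>x\<close> is already below
  \<open>p\<close>.\<close>

lemma imp_down_adjoint:
  assumes "a \<in> carrier (down L p)" "b \<in> carrier (down L p)" "x \<in> carrier (down L p)"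
  shows "x \<sqsubseteq> p \<sqinter> imp L a b \<longleftrightarrow> x \<sqinter>\<^bsub>down L p\<^esub> a \<sqsubseteq> b"
  using assms by (simp add: meet_down le_meet_iff le_imp_iff p)

lemma imp_down:
  "\<lbrakk>a \<in> carrier (down L p); b \<in> carrier (down L p)\<rbrakk> \<Longrightarrow> imp (down L p) a b = p \<sqinter> imp L a b"
  by (rule D.imp_eqI) (use imp_down_adjoint[of a b] in \<open>auto simp: p meet_left\<close>)

lemma heyting_algebra_down: "heyting_algebra (down L p)"
proof unfold_locales
  show "\<exists>x. least (down L p) x (carrier (down L p))"
    by (rule exI[of _ "\<bottom>"]) (auto simp: least_def p)
  show "\<exists>x. greatest (down L p) x (carrier (down L p))"
    by (rule exI[of _ p]) (auto simp: greatest_def p)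
  fix a b
  assume ab: "a \<in> carrier (down L p)" "b \<in> carrier (down L p)"
  show "\<exists>s. is_lub (down L p) s {a, b}" "\<exists>s. is_glb (down L p) s {a, b}"
    using is_lub_down[OF ab] is_glb_down[OF ab] by blast+
  show "\<exists>c\<in>carrier (down L p). \<forall>x\<in>carrier (down L p).
      x \<sqsubseteq>\<^bsub>down L p\<^esub> c \<longleftrightarrow> x \<sqinter>\<^bsub>down L p\<^esub> a \<sqsubseteq>\<^bsub>down L p\<^esub> b"
    by (rule bexI[of _ "p \<sqinter> imp L a b"])
      (use imp_down_adjoint[OF ab] ab in \<open>auto simp: p meet_left\<close>)
qed

text \<open>Meets are preserved by idempotence and joins by distributivity. Implication needs the
  argument below.\<close>

lemma preserves_heyting_meet: "preserves_heyting L (down L p) (\<lambda>a. p \<sqinter> a)"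
proof -
  have meet: "p \<sqinter> (a \<sqinter> b) = (p \<sqinter> a) \<sqinter> (p \<sqinter> b)" if "a \<in> carrier L" "b \<in> carrier L" for a b
    using that p by (intro le_antisym) (auto simp: le_meet_iff meet_left meet_right
      intro: le_trans[OF meet_right meet_left] le_trans[OF meet_right meet_right]
        le_trans[OF meet_left meet_left] le_trans[OF meet_left meet_right])
  have imp: "p \<sqinter> imp L a b = p \<sqinter> imp L (p \<sqinter> a) (p \<sqinter> b)"
    if ab: "a \<in> carrier L" "b \<in> carrier L" for a b
  proof (rule eq_if_same_lower)
    fix x
    assume x: "x \<in> carrier L"
    \<comment> \<open>Below \<open>p\<close>, meeting either argument with \<open>p\<close> changes
      nothing. An \<open>x\<close> not below \<open>p\<close> fails both sides of the goal, so this
      case suffices.\<close>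
    have "x \<sqinter> a \<sqsubseteq> b \<longleftrightarrow> x \<sqinter> (p \<sqinter> a) \<sqsubseteq> p \<sqinter> b" if "x \<sqsubseteq> p"
    proof -
      have "x \<sqinter> (p \<sqinter> a) = x \<sqinter> a"
        using that ab p x by (intro eq_if_same_lower) (auto simp: le_meet_iff intro: le_trans)
      then show ?thesis
        using that ab p x by (simp add: le_meet_iff meet_le_left_trans)
    qed
    then show "x \<sqsubseteq> p \<sqinter> imp L a b \<longleftrightarrow> x \<sqsubseteq> p \<sqinter> imp L (p \<sqinter> a) (p \<sqinter> b)"
      using ab p x by (auto simp: le_meet_iff le_imp_iff)
  qed (use ab p in auto)
  have top: "p \<sqinter> \<top> = p" and bottom: "p \<sqinter> \<bottom> = \<bottom>"
    using p by (auto intro!: eq_if_same_lower simp: le_meet_iff intro: le_trans[OF _ bottom_lower])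
  show ?thesis
    unfolding preserves_heyting_def preserves_finite_meets_def
  proof (intro conjI ballI)
    fix a b
    assume ab: "a \<in> carrier L" "b \<in> carrier L"
    have c: "p \<sqinter> a \<in> carrier (down L p)" "p \<sqinter> b \<in> carrier (down L p)"
      using ab p by (simp_all add: meet_left)
    show "p \<sqinter> (a \<sqinter> b) = (p \<sqinter> a) \<sqinter>\<^bsub>down L p\<^esub> (p \<sqinter> b)"
      "p \<sqinter> (a \<squnion> b) = (p \<sqinter> a) \<squnion>\<^bsub>down L p\<^esub> (p \<sqinter> b)"
      "p \<sqinter> imp L a b = imp (down L p) (p \<sqinter> a) (p \<sqinter> b)"
      by (simp_all only: meet_down[OF c] join_down[OF c] imp_down[OF c] meet[OF ab] imp[OF ab]
        meet_distrib_join[OF p ab])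
  qed (simp_all add: top_down bottom_down top bottom)
qed

text \<open>An element of the down-set is its own image under the homomorphism
  \<open>p \<sqinter> -\<close>, so its double negation there is the image of its double negation in
  \<open>L\<close>.\<close>

lemma neg_neg_down:
  assumes "\<And>a. a \<in> carrier L \<Longrightarrow> neg L (neg L a) = a" "a \<in> carrier (down L p)"
  shows "neg (down L p) (neg (down L p) a) = a"
proof -
  have bot: "p \<sqinter> \<bottom> = \<bottom>\<^bsub>down L p\<^esub>"
    using preserves_heyting_meet by (simp add: preserves_heyting_def)
  have neg: "p \<sqinter> neg L b = neg (down L p) (p \<sqinter> b)" if "b \<in> carrier L" for b
    using that preserves_heyting_meet by (simp add: preserves_heyting_def neg_def bot)
  have a: "a \<in> carrier L" "p \<sqinter> a = a"
    using assms(2) p by (auto intro!: eq_if_same_lower simp: le_meet_iff intro: le_trans)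
  then show ?thesis
    using assms(1) by (metis neg neg_closed)
qed

end

end

text \<open>The order is equational: \<open>a\<close> is below \<open>b\<close> exactly when their
  meet is \<open>a\<close>, and \<open>h\<close> preserves this equation. Monotonicity of the
  Kleisli reindexings and of the canonical transformation is obtained this way.\<close>

lemma preserves_heyting_isotone:
  assumes "heyting_algebra L" "heyting_algebra M" "h \<in> carrier L \<rightarrow> carrier M"
    and "preserves_heyting L M h"
  shows "isotone L M h"
proof -
  interpret L: heyting_algebra L by fact
  interpret M: heyting_algebra M by fact
  show ?thesis
  proof
    fix a b
    assume ab: "a \<in> carrier L" "b \<in> carrier L" "a \<sqsubseteq>\<^bsub>L\<^esub> b"
    then have "a \<sqinter>\<^bsub>L\<^esub> b = a"
      by (auto intro!: L.eq_if_same_lower simp: L.le_meet_iff intro: L.le_trans)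
    then have "h a = h a \<sqinter>\<^bsub>M\<^esub> h b"
      using assms(4) ab unfolding preserves_heyting_def preserves_finite_meets_def by metis
    then show "h a \<sqsubseteq>\<^bsub>M\<^esub> h b"
      using M.meet_right[of "h a" "h b"] ab assms(3) by auto
  qed (rule L.weak_partial_order_axioms M.weak_partial_order_axioms)+
qed

text \<open>Monotonicity keeps \<open>h\<close> inside the down-sets. The operations there are built
  from \<open>p\<close> and the ambient operations, and \<open>h\<close> carries each formula for
  \<open>p\<close> to the same formula for \<open>h p\<close>.\<close>

lemma preserves_heyting_down:
  assumes L: "heyting_algebra L" and M: "heyting_algebra M"
    and closed: "h \<in> carrier L \<rightarrow> carrier M" and h: "preserves_heyting L M h"
    and p: "p \<in> carrier L"
  shows "h \<in> carrier (down L p) \<rightarrow> carrier (down M (h p))"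
    and "preserves_heyting (down L p) (down M (h p)) h"
proof -
  interpret L: heyting_algebra L by fact
  interpret M: heyting_algebra M by fact
  have hp: "h p \<in> carrier M"
    using closed p by auto
  show maps: "h \<in> carrier (down L p) \<rightarrow> carrier (down M (h p))"
    using closed p use_iso2[OF preserves_heyting_isotone[OF L M closed h]] by auto
  show "preserves_heyting (down L p) (down M (h p)) h"
    unfolding preserves_heyting_def preserves_finite_meets_def
  proof (intro conjI ballI)
    show "h \<top>\<^bsub>down L p\<^esub> = \<top>\<^bsub>down M (h p)\<^esub>" "h \<bottom>\<^bsub>down L p\<^esub> = \<bottom>\<^bsub>down M (h p)\<^esub>"
      using h p hp by (simp_all add: L.top_down M.top_down L.bottom_down M.bottom_down
          preserves_heyting_def)
    fix a b
    assume ab: "a \<in> carrier (down L p)" "b \<in> carrier (down L p)"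
    then have ab': "a \<in> carrier L" "b \<in> carrier L"
      by simp_all
    have hab: "h a \<in> carrier (down M (h p))" "h b \<in> carrier (down M (h p))"
      using maps ab by (blast dest: funcset_mem)+
    note ops = L.meet_down[OF p ab] L.join_down[OF p ab] L.imp_down[OF p ab]
      M.meet_down[OF hp hab] M.join_down[OF hp hab] M.imp_down[OF hp hab]
    show "h (a \<sqinter>\<^bsub>down L p\<^esub> b) = h a \<sqinter>\<^bsub>down M (h p)\<^esub> h b"
      "h (a \<squnion>\<^bsub>down L p\<^esub> b) = h a \<squnion>\<^bsub>down M (h p)\<^esub> h b"
      "h (imp (down L p) a b) = imp (down M (h p)) (h a) (h b)"
      using h ab' p unfolding ops preserves_heyting_def preserves_finite_meets_def by simp_all
  qed
qed

lemma preserves_heyting_comp: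
  assumes "g \<in> carrier L \<rightarrow> carrier M"
    and "preserves_heyting L M g" "preserves_heyting M N h"
  shows "preserves_heyting L N (\<lambda>a. h (g a))"
  using assms unfolding preserves_heyting_def preserves_finite_meets_def by (simp add: Pi_iff)

lemma preserves_heyting_neg:
  assumes "heyting_algebra L" "preserves_heyting L M h" "a \<in> carrier L"
  shows "h (neg L a) = neg M (h a)"
proof -
  interpret L: heyting_algebra L by fact
  show ?thesis
    using assms by (simp add: neg_def preserves_heyting_def)
qed

section \<open>Boolean doctrines\<close>

text \<open>Reduces the isomorphism condition to a fibrewise equation. Forwards, surjectivity makes
  every element a negation, so triple negation collapses to it. Backwards, negation is its own
  inverse, and it is natural because reindexings preserve it.\<close>

lemma boolean_doctrine_iff:
  assumes P: "heyting_doctrine P"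
  shows "boolean_doctrine P \<longleftrightarrow>
    (\<forall>A\<in>Obj (base P). \<forall>a\<in>carrier (fib P A). neg (fib P A) (neg (fib P A) a) = a)"
proof
  assume "boolean_doctrine P"
  then have bij: "bij_betw (neg (fib P A)) (carrier (fib P A)) (carrier (fib P A))"
    if "A \<in> Obj (base P)" for A
    using that by (simp add: boolean_doctrine_def doctrine_iso_def op_doctrine_def)
  show "\<forall>A\<in>Obj (base P). \<forall>a\<in>carrier (fib P A). neg (fib P A) (neg (fib P A) a) = a"
  proof (intro ballI)
    fix A a
    assume A: "A \<in> Obj (base P)" and "a \<in> carrier (fib P A)"
    then obtain b where "b \<in> carrier (fib P A)" "a = neg (fib P A) b"
      using bij[OF A] by (auto simp: bij_betw_def)
    then show "neg (fib P A) (neg (fib P A) a) = a"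
      using P A heyting_algebra.neg_neg_neg unfolding heyting_doctrine_def by metis
  qed
next
  assume nn: "\<forall>A\<in>Obj (base P). \<forall>a\<in>carrier (fib P A). neg (fib P A) (neg (fib P A) a) = a"
  have fibre: "neg (fib P A) \<in> carrier (fib P A) \<rightarrow> carrier (fib P A) \<and>
      bij_betw (neg (fib P A)) (carrier (fib P A)) (carrier (fib P A)) \<and>
      order_emb (inv_gorder (fib P A)) (fib P A) (neg (fib P A))" if A: "A \<in> Obj (base P)" for A
  proof -
    interpret L: heyting_algebra "fib P A"
      using P A by (simp add: heyting_doctrine_def)
    have "neg (fib P A) a \<sqsubseteq>\<^bsub>fib P A\<^esub> neg (fib P A) b \<longleftrightarrow> b \<sqsubseteq>\<^bsub>fib P A\<^esub> a"
      if "a \<in> carrier (fib P A)" "b \<in> carrier (fib P A)" for a b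
      \<comment> \<open>This instance has \<open>b\<close> below the double negation of
        \<open>a\<close> on its right-hand side, and that double negation is
        \<open>a\<close>.\<close>
      using that nn A L.neg_galois[of "neg (fib P A) a" b] by simp
    moreover have "bij_betw (neg (fib P A)) (carrier (fib P A)) (carrier (fib P A))"
      using nn A by (intro bij_betw_byWitness[where f' = "neg (fib P A)"]) auto
    ultimately show ?thesis
      using L.dual_weak_order L.weak_partial_order_axioms by (auto simp: order_emb_def)
  qed
  have nat: "neg (fib P A) (reind P A B f b) = reind P A B f (neg (fib P B) b)"
    if "A \<in> Obj (base P)" "B \<in> Obj (base P)" "f \<in> Hom (base P) A B" "b \<in> carrier (fib P B)"
    for A B f b
    using that P preserves_heyting_neg[of "fib P B" "fib P A" "reind P A B f"]
    by (simp add: heyting_doctrine_def)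
  show "boolean_doctrine P"
    unfolding boolean_doctrine_def doctrine_iso_def doctrine_trans_def op_doctrine_def
    using P fibre nat by (auto intro: order_emb_isotone dest!: fibre)
qed

section \<open>The Kleisli category\<close>

context fp_category
begin

lemma prod_obj [simp]: "\<lbrakk>A \<in> Obj C; B \<in> Obj C\<rbrakk> \<Longrightarrow> Prod C A B \<in> Obj C"
  and pr1_in_hom [simp]: "\<lbrakk>A \<in> Obj C; B \<in> Obj C\<rbrakk> \<Longrightarrow> Pr1 C A B \<in> Hom C (Prod C A B) A"
  and pr2_in_hom [simp]: "\<lbrakk>A \<in> Obj C; B \<in> Obj C\<rbrakk> \<Longrightarrow> Pr2 C A B \<in> Hom C (Prod C A B) B"
  using product[of A B] by (simp_all add: is_product_def)

lemma pairing_unique: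
  assumes "Z \<in> Obj C" "A \<in> Obj C" "B \<in> Obj C" "h \<in> Hom C Z (Prod C A B)"
    and "Comp C Z (Prod C A B) A (Pr1 C A B) h = f" "Comp C Z (Prod C A B) B (Pr2 C A B) h = g"
  shows "pairing C Z A B f g = h"
proof -
  \<comment> \<open>The typing of \<open>f\<close> and \<open>g\<close> follows from that of
    \<open>h\<close>, since they are its components.\<close>
  have "f \<in> Hom C Z A" "g \<in> Hom C Z B"
    using assms comp_in_hom pr1_in_hom pr2_in_hom prod_obj by metis+
  then show ?thesis
    unfolding pairing_def using assms product[of A B] unfolding is_product_def
    by (intro the1_equality) auto
qed

lemma pairing_props:
  assumes "Z \<in> Obj C" "A \<in> Obj C" "B \<in> Obj C" "f \<in> Hom C Z A" "g \<in> Hom C Z B"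
  shows pairing_in_hom: "pairing C Z A B f g \<in> Hom C Z (Prod C A B)"
    and pr1_pairing: "Comp C Z (Prod C A B) A (Pr1 C A B) (pairing C Z A B f g) = f"
    and pr2_pairing: "Comp C Z (Prod C A B) B (Pr2 C A B) (pairing C Z A B f g) = g"
proof -
  obtain h where "h \<in> Hom C Z (Prod C A B)"
    "Comp C Z (Prod C A B) A (Pr1 C A B) h = f" "Comp C Z (Prod C A B) B (Pr2 C A B) h = g"
    using product[of A B] assms unfolding is_product_def by blast
  with pairing_unique[of Z A B h f g] assms
  show "pairing C Z A B f g \<in> Hom C Z (Prod C A B)"
    "Comp C Z (Prod C A B) A (Pr1 C A B) (pairing C Z A B f g) = f"
    "Comp C Z (Prod C A B) B (Pr2 C A B) (pairing C Z A B f g) = g"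
    by simp_all
qed

end

section \<open>Kleisli arrows as arrows over \<open>X\<close>\<close>

locale kleisli = fp_category C for C :: "('o, 'a) fpcat" +
  fixes X :: 'o
  assumes X [simp]: "X \<in> Obj C"
begin

abbreviation "K \<equiv> kleisli_category C X"
abbreviation "lift \<equiv> kleisli_lift C X"
abbreviation "XP \<equiv> Prod C X"

lemma
  assumes "A \<in> Obj C" "B \<in> Obj C" "g \<in> Hom C (XP A) B"
  shows lift_in_hom: "lift A B g \<in> Hom C (XP A) (XP B)"
    and pr1_lift: "Comp C (XP A) (XP B) X (Pr1 C X B) (lift A B g) = Pr1 C X A"
    and pr2_lift: "Comp C (XP A) (XP B) B (Pr2 C X B) (lift A B g) = g"
  unfolding kleisli_lift_def using assms by (simp_all add: pairing_props)

text \<open>An arrow commuting with the projections to \<open>X\<close> is determined by its second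
  component. Hence \<open>lift\<close> identifies Kleisli arrows with arrows over \<open>X\<close>
  between the products \<open>XP A\<close>.\<close>

lemma lift_unique:
  assumes "A \<in> Obj C" "B \<in> Obj C" "h \<in> Hom C (XP A) (XP B)"
    and "Comp C (XP A) (XP B) X (Pr1 C X B) h = Pr1 C X A"
    and "Comp C (XP A) (XP B) B (Pr2 C X B) h = g"
  shows "lift A B g = h"
  unfolding kleisli_lift_def using assms by (simp add: pairing_unique)

lemma lift_ident: "A \<in> Obj C \<Longrightarrow> lift A A (Pr2 C X A) = Ident C (XP A)"
  by (rule lift_unique) (simp_all add: ident_in_hom comp_ident_right[of "XP A"])

text \<open>Both sides lie over \<open>X\<close> and have the same second component. With
  \<open>lift_ident\<close> this makes \<open>lift\<close> functorial, which gives associativity in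
  \<open>K\<close> and functoriality of the Kleisli reindexings.\<close>

lemma lift_comp:
  assumes "A \<in> Obj C" "B \<in> Obj C" "D \<in> Obj C" "g \<in> Hom C (XP A) B" "h \<in> Hom C (XP B) D"
  shows "lift A D (Comp C (XP A) (XP B) D h (lift A B g)) =
    Comp C (XP A) (XP B) (XP D) (lift B D h) (lift A B g)"
  using assms
  by (intro lift_unique)
    (simp_all add: lift_in_hom pr1_lift pr2_lift comp_in_hom[where B = "XP B"]
      comp_assoc[where B = "XP B" and D = "XP D"])

lemma kleisli_category_sel [simp]:
  "Obj K = Obj C" "Hom K A B = Hom C (XP A) B" "Ident K A = Pr2 C X A"
  "Comp K A B D h g = Comp C (XP A) (XP B) D h (lift A B g)"
  "Term K = Term C" "Prod K = Prod C"
  "Pr1 K A B = Comp C (XP (Prod C A B)) (Prod C A B) A (Pr1 C A B) (Pr2 C X (Prod C A B))"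
  "Pr2 K A B = Comp C (XP (Prod C A B)) (Prod C A B) B (Pr2 C A B) (Pr2 C X (Prod C A B))"
  by (simp_all add: kleisli_category_def)

lemma category_kleisli: "category K"
proof
  fix A B D E f g h
  show "Ident K A \<in> Hom K A A" if "A \<in> Obj K"
    using that by simp
  show "Comp K A B D g f \<in> Hom K A D"
    if "A \<in> Obj K" "B \<in> Obj K" "D \<in> Obj K" "f \<in> Hom K A B" "g \<in> Hom K B D"
    using that by (simp add: comp_in_hom[where B = "XP B"] lift_in_hom)
  show "Comp K A A B f (Ident K A) = f" "Comp K A B B (Ident K B) f = f"
    if "A \<in> Obj K" "B \<in> Obj K" "f \<in> Hom K A B"
    using that by (simp_all add: lift_ident pr2_lift comp_ident_right)
  show "Comp K A D E h (Comp K A B D g f) = Comp K A B E (Comp K B D E h g) f"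
    if "A \<in> Obj K" "B \<in> Obj K" "D \<in> Obj K" "E \<in> Obj K"
      "f \<in> Hom K A B" "g \<in> Hom K B D" "h \<in> Hom K D E"
    using that
    by (simp add: lift_comp lift_in_hom comp_assoc[where B = "XP B" and D = "XP D"])
qed

section \<open>The canonical functor and finite products\<close>

abbreviation "F \<equiv> kleisli_functor C X"

lemma kleisli_functor_sel [simp]:
  "fobj F A = A" "farr F A B f = Comp C (XP A) A B f (Pr2 C X A)"
  by (simp_all add: kleisli_functor_def)

text \<open>An arrow in the image of \<open>F\<close> ignores the parameter in \<open>X\<close>:
  composing \<open>f pr\<^sub>2\<close> with \<open>\<langle>pr\<^sub>1, g\<rangle>\<close> leaves
  \<open>f g\<close>. Composites with such arrows can therefore be computed in
  \<open>C\<close>.\<close>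

lemma comp_functor_image:
  assumes "A \<in> Obj C" "B \<in> Obj C" "D \<in> Obj C" "g \<in> Hom C (XP A) B" "f \<in> Hom C B D"
  shows "Comp K A B D (farr F B D f) g = Comp C (XP A) B D f g"
  using assms
  by (simp add: pr2_lift lift_in_hom comp_assoc[where B = "XP B" and D = "B", symmetric])

lemma is_functor_kleisli: "is_functor C K F"
proof -
  have "farr F A E (Comp C A B E g f) = Comp K A B E (farr F B E g) (farr F A B f)"
    if "A \<in> Obj C" "B \<in> Obj C" "E \<in> Obj C" "f \<in> Hom C A B" "g \<in> Hom C B E" for A B E f g
    using that
    by (subst comp_functor_image)
      (simp_all add: comp_in_hom[where B = A] comp_assoc[where B = A and D = B])
  then show ?thesis
    unfolding is_functor_def
    by (simp add: category_kleisli category_axioms comp_ident_left comp_in_hom)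
qed

lemma is_product_functor_image:
  assumes "A \<in> Obj C" "B \<in> Obj C" "is_product C A B Q p q"
  shows "is_product K A B Q (farr F Q A p) (farr F Q B q)"
proof -
  have Q: "Q \<in> Obj C" "p \<in> Hom C Q A" "q \<in> Hom C Q B"
    using assms by (auto simp: is_product_def)
  have "\<exists>!h. h \<in> Hom K Z Q \<and> Comp K Z Q A (farr F Q A p) h = f \<and>
      Comp K Z Q B (farr F Q B q) h = g"
    if "Z \<in> Obj C" "f \<in> Hom C (XP Z) A" "g \<in> Hom C (XP Z) B" for Z f g
  proof -
    \<comment> \<open>A cone on \<open>Z\<close> in \<open>K\<close> is a cone on
      \<open>XP Z\<close> in \<open>C\<close>, so the universal property of \<open>Q\<close> is used
      at \<open>XP Z\<close>. The congruence rule below supplies the typing of \<open>h\<close>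
      needed to rewrite the two composites.\<close>
    have "\<exists>!h. h \<in> Hom C (XP Z) Q \<and> Comp C (XP Z) Q A p h = f \<and> Comp C (XP Z) Q B q h = g"
      using assms that by (simp add: is_product_def)
    then show ?thesis
      using comp_functor_image[of Z Q _ _ ] assms Q that
      by (simp only: kleisli_category_sel(2) cong: conj_cong)
  qed
  then show ?thesis
    using assms Q unfolding is_product_def by (auto intro: comp_in_hom)
qed

text \<open>Terminality in \<open>C\<close> is applied at the objects \<open>XP A\<close>.\<close>

lemma is_terminal_kleisli: "is_terminal C T \<Longrightarrow> is_terminal K T"
  by (simp add: is_terminal_def)

lemma preserves_finite_products_kleisli: "preserves_finite_products C K F"
  unfolding preserves_finite_products_def
  using is_product_functor_image is_terminal_kleisli by auto

lemma fp_category_kleisli: "fp_category K"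
proof -
  interpret K: category K by (rule category_kleisli)
  show ?thesis
    by unfold_locales
      (use is_terminal_kleisli[OF terminal] is_product_functor_image[OF _ _ product] in auto)
qed

end

section \<open>The Kleisli doctrine\<close>

locale kleisli_heyting_doctrine =
  fixes P :: "('o, 'a, 'p) doctr" and X :: 'o and \<phi> :: 'p
  assumes P: "heyting_doctrine P"
    and X: "X \<in> Obj (base P)"
    and \<phi>: "\<phi> \<in> carrier (fib P X)"
begin

sublocale kleisli "base P" X
  using P X by (simp add: heyting_doctrine_def doctrine_def kleisli_def kleisli_axioms_def)

abbreviation "R \<equiv> kleisli_doctrine P X \<phi>"
abbreviation "bound A \<equiv> reind P (XP A) X (Pr1 (base P) X A) \<phi>"

lemma kleisli_doctrine_sel [simp]:
  "base R = K"
  "fib R A = down (fib P (XP A)) (bound A)"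
  "reind R A B g = reind P (XP A) (XP B) (lift A B g)"
  by (simp_all add: kleisli_doctrine_def down_def Let_def)

lemma heyting_fibre: "A \<in> Obj (base P) \<Longrightarrow> heyting_algebra (fib P A)"
  and reind_closed:
    "\<lbrakk>A \<in> Obj (base P); B \<in> Obj (base P); f \<in> Hom (base P) A B\<rbrakk>
      \<Longrightarrow> reind P A B f \<in> carrier (fib P B) \<rightarrow> carrier (fib P A)"
  and reind_heyting:
    "\<lbrakk>A \<in> Obj (base P); B \<in> Obj (base P); f \<in> Hom (base P) A B\<rbrakk>
      \<Longrightarrow> preserves_heyting (fib P B) (fib P A) (reind P A B f)"
  and reind_ident:
    "\<lbrakk>A \<in> Obj (base P); \<alpha> \<in> carrier (fib P A)\<rbrakk> \<Longrightarrow> reind P A A (Ident (base P) A) \<alpha> = \<alpha>"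
  and reind_comp:
    "\<lbrakk>A \<in> Obj (base P); B \<in> Obj (base P); D \<in> Obj (base P);
      f \<in> Hom (base P) A B; g \<in> Hom (base P) B D; \<alpha> \<in> carrier (fib P D)\<rbrakk>
      \<Longrightarrow> reind P A D (Comp (base P) A B D g f) \<alpha> = reind P A B f (reind P B D g \<alpha>)"
  using P by (simp_all add: heyting_doctrine_def doctrine_def)

lemma bound_closed [simp]: "A \<in> Obj (base P) \<Longrightarrow> bound A \<in> carrier (fib P (XP A))"
  using reind_closed[of "XP A" X "Pr1 (base P) X A"] \<phi> X by auto

text \<open>Functoriality of reindexing, since the first projection after \<open>lift A B g\<close>
  is again the first projection.\<close>

lemma reind_lift_bound:
  assumes "A \<in> Obj (base P)" "B \<in> Obj (base P)" "g \<in> Hom (base P) (XP A) B"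
  shows "reind P (XP A) (XP B) (lift A B g) (bound B) = bound A"
  using assms X \<phi> by (simp add: reind_comp[symmetric] lift_in_hom pr1_lift)

text \<open>Restriction of a Heyting homomorphism to down-sets, applied to reindexing along
  \<open>lift A B g\<close>; by \<open>reind_lift_bound\<close> the target is the down-set of
  \<open>bound A\<close>.\<close>

lemma reind_kleisli:
  assumes "A \<in> Obj (base P)" "B \<in> Obj (base P)" "g \<in> Hom (base P) (XP A) B"
  shows reind_kleisli_closed: "reind R A B g \<in> carrier (fib R B) \<rightarrow> carrier (fib R A)"
    and reind_kleisli_heyting: "preserves_heyting (fib R B) (fib R A) (reind R A B g)"
  using preserves_heyting_down[of "fib P (XP B)" "fib P (XP A)"
      "reind P (XP A) (XP B) (lift A B g)" "bound B"] assms X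
  by (simp_all add: heyting_fibre reind_closed reind_heyting lift_in_hom reind_lift_bound
      del: carrier_down)

lemma heyting_kleisli_fibre: "A \<in> Obj (base P) \<Longrightarrow> heyting_algebra (fib R A)"
  using X by (simp add: heyting_algebra.heyting_algebra_down heyting_fibre)

lemma doctrine_kleisli: "doctrine R"
  unfolding doctrine_def
proof (intro conjI ballI)
  show "fp_category (base R)"
    by (simp add: fp_category_kleisli)
  fix A
  assume "A \<in> Obj (base R)"
  then have A: "A \<in> Obj (base P)"
    by simp
  interpret L: heyting_algebra "fib R A"
    by (rule heyting_kleisli_fibre[OF A])
  show "partial_order (fib R A)"
    by (rule L.partial_order_axioms)
  show "reind R A A (Ident (base R) A) \<alpha> = \<alpha>" if "\<alpha> \<in> carrier (fib R A)" for \<alpha>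
    using that A X by (simp add: lift_ident reind_ident)
  fix B g
  assume "B \<in> Obj (base R)" "g \<in> Hom (base R) A B"
  then have B: "B \<in> Obj (base P)" "g \<in> Hom (base P) (XP A) B"
    by simp_all
  show "reind R A B g \<in> carrier (fib R B) \<rightarrow> carrier (fib R A)"
    by (rule reind_kleisli_closed[OF A B])
  show "isotone (fib R B) (fib R A) (reind R A B g)"
    by (rule preserves_heyting_isotone[OF heyting_kleisli_fibre[OF B(1)]
          heyting_kleisli_fibre[OF A] reind_kleisli[OF A B]])
  fix D h \<alpha>
  assume "D \<in> Obj (base R)" "h \<in> Hom (base R) B D" "\<alpha> \<in> carrier (fib R D)"
  then show "reind R A D (Comp (base R) A B D h g) \<alpha> = reind R A B g (reind R B D h \<alpha>)"
    using A B X by (simp add: lift_comp reind_comp lift_in_hom)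
qed

lemma heyting_doctrine_kleisli: "heyting_doctrine R"
  unfolding heyting_doctrine_def
  using doctrine_kleisli heyting_kleisli_fibre reind_kleisli_heyting
  by (simp del: kleisli_doctrine_sel(2,3))

lemma boolean_doctrine_kleisli: "boolean_doctrine P \<Longrightarrow> boolean_doctrine R"
  using X by (simp add: boolean_doctrine_iff P heyting_doctrine_kleisli
      heyting_algebra.neg_neg_down heyting_fibre)

section \<open>The canonical transformation\<close>

lemma kleisli_trans_eq:
  "kleisli_trans P X \<phi> A =
    (\<lambda>\<alpha>. bound A \<sqinter>\<^bsub>fib P (XP A)\<^esub> reind P (XP A) A (Pr2 (base P) X A) \<alpha>)"
  by (simp add: kleisli_trans_def Let_def fun_eq_iff)

lemma kleisli_trans_closed:
  assumes A: "A \<in> Obj (base P)"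
  shows "kleisli_trans P X \<phi> A \<in> carrier (fib P A) \<rightarrow> carrier (fib R A)"
proof -
  interpret L: heyting_algebra "fib P (XP A)"
    using A X by (simp add: heyting_fibre)
  show ?thesis
    using reind_closed[of "XP A" A "Pr2 (base P) X A"] A X
    by (auto simp: kleisli_trans_eq L.meet_left Pi_iff)
qed

text \<open>The component is reindexing along the second projection followed by meeting with
  \<open>bound A\<close>, a composite of two Heyting homomorphisms.\<close>

lemma kleisli_trans_heyting:
  assumes A: "A \<in> Obj (base P)"
  shows "preserves_heyting (fib P A) (fib R A) (kleisli_trans P X \<phi> A)"
  unfolding kleisli_trans_eq kleisli_doctrine_sel using A X
  by (intro preserves_heyting_comp[OF reind_closed reind_heyting]
      heyting_algebra.preserves_heyting_meet) (simp_all add: heyting_fibre)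

text \<open>Both sides reindex \<open>\<beta>\<close> along \<open>f pr\<^sub>2 : X \<times> A \<rightarrow> B\<close>.\<close>

lemma kleisli_trans_natural:
  assumes AB: "A \<in> Obj (base P)" "B \<in> Obj (base P)"
    and f: "f \<in> Hom (base P) A B" and \<beta>: "\<beta> \<in> carrier (fib P B)"
  shows "kleisli_trans P X \<phi> A (reind P A B f \<beta>) =
    reind R A B (farr F A B f) (kleisli_trans P X \<phi> B \<beta>)"
proof -
  let ?g = "farr F A B f"
  have g: "?g \<in> Hom (base P) (XP A) B"
    using AB f X by (simp add: comp_in_hom)
  have \<beta>': "reind P (XP B) B (Pr2 (base P) X B) \<beta> \<in> carrier (fib P (XP B))"
    using reind_closed[of "XP B" B "Pr2 (base P) X B"] AB X \<beta> by auto
  have "reind P (XP A) (XP B) (lift A B ?g) (reind P (XP B) B (Pr2 (base P) X B) \<beta>) =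
      reind P (XP A) B ?g \<beta>"
    using AB g X \<beta> by (simp add: reind_comp[symmetric] lift_in_hom pr2_lift
        del: kleisli_functor_sel)
  also have "\<dots> = reind P (XP A) A (Pr2 (base P) X A) (reind P A B f \<beta>)"
    using AB f X \<beta> by (simp add: reind_comp)
  finally show ?thesis
    using reind_heyting[OF _ _ lift_in_hom[OF AB g]] AB g X \<beta>'
    by (simp add: kleisli_trans_eq preserves_heyting_def preserves_finite_meets_def
        reind_lift_bound del: kleisli_functor_sel)
qed

lemma doctrine_hom_kleisli: "doctrine_hom P R (kleisli_hom P X \<phi>)"
proof -
  have "isotone (fib P A) (fib R A) (kleisli_trans P X \<phi> A)" if "A \<in> Obj (base P)" for A
    using that by (intro preserves_heyting_isotone heyting_fibre heyting_kleisli_fibre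
        kleisli_trans_closed kleisli_trans_heyting)
  then have "doctrine_trans P (reindex_functor R (base P) F) (kleisli_trans P X \<phi>)"
    unfolding doctrine_trans_def reindex_functor_def
    using kleisli_trans_closed kleisli_trans_natural
    by (simp del: kleisli_doctrine_sel(2,3) kleisli_functor_sel(2))
  then show ?thesis
    using P doctrine_kleisli is_functor_kleisli preserves_finite_products_kleisli
    by (simp add: doctrine_hom_def kleisli_hom_def heyting_doctrine_def)
qed

end

theorem proposition5p11:
  fixes P :: "('o, 'a, 'p) doctr" and X :: 'o and \<phi> :: 'p
  assumes "primary_doctrine P"
    and "X \<in> Obj (base P)"
    and "\<phi> \<in> carrier (fib P X)"
    and "boolean_doctrine P"
  shows "boolean_doctrine (kleisli_doctrine P X \<phi>)
    \<and> boolean_hom P (kleisli_doctrine P X \<phi>) (kleisli_hom P X \<phi>)"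
proof -
  interpret kleisli_heyting_doctrine P X \<phi>
    using assms by unfold_locales (simp_all add: boolean_doctrine_def)
  have "boolean_doctrine R"
    by (rule boolean_doctrine_kleisli[OF assms(4)])
  moreover from this have "boolean_hom P R (kleisli_hom P X \<phi>)"
    using assms(4) doctrine_hom_kleisli kleisli_trans_heyting
    by (simp add: boolean_hom_def kleisli_hom_def)
  ultimately show ?thesis ..
qed

end
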